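(* Let $H$ be a reduced commutative Krull monoid, $F=\mathcal F(P)$ a free abelian monoid with basis $P$ such that $H\subset F$ is a submonoid and the embedding $H\hookrightarrow F$ is a cofinal divisor homomorphism with class group $G=\mathsf q(F)/\mathsf q(H)$, and let $G_0=\{[p]\mid p\in P\}\subset G$ denote the set of classes containing prime divisors. Then there is a transfer homomorphism $\boldsymbol\beta\colon H\to\mathcal B(G_0)$. In particular, $\mathcal L(H)=\mathcal L(\mathcal B(G_0))$.
   Context: A monoid is a cancelative semigroup with identity; $H^\times$ is its group of invertible elements; $H$ is reduced if $H^\times=\{1\}$. For a commutative monoid $H$, $\mathsf q(H)$ is its quotient group and $H_{\mathrm{red}}=H/H^\times$. A homomorphism $\varphi\colon H\to D$ of commutative monoids is a divisor homomorphism if $\varphi(a)\mid\varphi(b)$ in $D$ implies $a\mid b$ in $H$ for all $a,b\in H$; it is cofinal if every $\alpha\in D$ divides some $\varphi(a)$, $a\in H$. A commutative monoid $H$ is Krull if there is a free abelian monoid $F$ such that there is an inclusion $H_{\mathrm{red}}\hookrightarrow F$ which is a divisor homomorphism. For $a\in\mathsf q(F)$, $[a]=a\,\mathsf q(H)\in G=\mathsf q(F)/\mathsf q(H)$; $G$ is written additively. For a subset $G_0$ of an additive abelian group, $\mathcal F(G_0)$ is the free abelian monoid with basis $G_0$ (its elements are called sequences over $G_0$). For $S=g_1\cdots g_\ell\in\mathcal F(G_0)$ put $\sigma(S)=g_1+\dots+g_\ell$. The monoid of zero-sum sequences is $\mathcal B(G_0)=\{S\in\mathcal F(G_0)\mid\sigma(S)=0\}$.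 An atom is a non-invertible element $a$ such that $a=uv$ implies $u$ or $v$ is invertible; $\mathcal A(H)$ is the set of atoms; $H$ is atomic if every non-invertible element is a finite product of atoms. $\mathsf L(a)$ is the set of all $k\in\mathbb N$ such that $a$ is a product of $k$ atoms (with $\mathsf L(a)=\{0\}$ for $a\in H^\times$), and $\mathcal L(H)=\{\mathsf L(a)\mid a\in H\}$. A homomorphism $\theta\colon H\to B$ between atomic commutative monoids is a transfer homomorphism if: (T1) $B=B^\times\theta(H)B^\times$ and $\theta^{-1}(B^\times)=H^\times$; (WT2) if $a\in H$, $n\in\mathbb N$, $v_1,\dots,v_n\in\mathcal A(B)$ and $\theta(a)=v_1\cdots v_n$, then there exist $u_1,\dots,u_n\in\mathcal A(H)$ and a permutation $\tau$ of $\{1,\dots,n\}$ such that $a=u_1\cdots u_n$ and $\theta(u_i)\in B^\times v_{\tau(i)}B^\times$ for each $i$. *)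

theory Defs
  imports "HOL-Algebra.Divisibility" "HOL-Algebra.FiniteProduct" "HOL-Library.Multiset"
    "HOL-Combinatorics.Permutations"
begin

section \<open>Commutative monoids, atoms and sets of lengths\<close>

text \<open>
  ``Monoid'' in the sense of factorization theory (commutative, cancellative, with identity) is the
  library locale \<^locale>\<open>comm_monoid_cancel\<close>; \<open>Units H\<close> is the group of invertible elements.
\<close>

definition reduced_monoid :: "('a, 'b) monoid_scheme \<Rightarrow> bool" where
  "reduced_monoid H \<longleftrightarrow> Units H = {\<one>\<^bsub>H\<^esub>}"

definition atoms :: "('a, 'b) monoid_scheme \<Rightarrow> 'a set" where
  "atoms H = {a \<in> carrier H. irreducible H a}"

definition atomic_monoid :: "('a, 'b) monoid_scheme \<Rightarrow> bool" where
  "atomic_monoid H \<longleftrightarrow>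
     (\<forall>a \<in> carrier H - Units H. \<exists>us. set us \<subseteq> atoms H \<and> factors H us a)"

text \<open>A non-unit is never the empty product, so no side condition \<open>us \<noteq> []\<close> is needed.\<close>

definition set_of_lengths :: "('a, 'b) monoid_scheme \<Rightarrow> 'a \<Rightarrow> nat set" where
  "set_of_lengths H a =
     (if a \<in> Units H then {0} else {length us | us. set us \<subseteq> atoms H \<and> factors H us a})"

definition system_of_lengths :: "('a, 'b) monoid_scheme \<Rightarrow> nat set set" where
  "system_of_lengths H = set_of_lengths H ` carrier H"

text \<open>The library's \<^const>\<open>irreducible\<close> is phrased by proper factors; it is the usual notion of atom.\<close>

lemma (in comm_monoid_cancel) mem_atoms_iff:
  "a \<in> atoms G \<longleftrightarrow> a \<in> carrier G \<and> a \<notin> Units G \<and>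
     (\<forall>u \<in> carrier G. \<forall>v \<in> carrier G. a = u \<otimes> v \<longrightarrow> u \<in> Units G \<or> v \<in> Units G)"
  (is "?l \<longleftrightarrow> ?r")
proof
  assume l: ?l
  have "u \<in> Units G \<or> v \<in> Units G" if "u \<in> carrier G" "v \<in> carrier G" "a = u \<otimes> v" for u v
  proof -
    have "irreducible G (u \<otimes> v)" using l that by (simp add: atoms_def)
    then show ?thesis using that(1,2) by (rule irreducible_prodE) simp_all
  qed
  then show ?r using l by (simp add: atoms_def irreducible_def)
next
  assume r: ?r
  have "b \<in> Units G" if b: "b \<in> carrier G" "properfactor G b a" for b
  proof -
    obtain c where c: "c \<in> carrier G" "a = b \<otimes> c"
      using b unfolding properfactor_def factor_def by auto
    have "c \<notin> Units G"
    proof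
      assume u: "c \<in> Units G"
      then have "b = a \<otimes> inv c" using b c by (simp add: m_assoc)
      then have "a divides b" using u unfolding factor_def by blast
      then show False using b by (simp add: properfactor_def)
    qed
    then show ?thesis using r b c by blast
  qed
  then show ?l using r by (auto simp: atoms_def irreducible_def)
qed


section \<open>Homomorphisms\<close>

definition monoid_homomorphism ::
  "('a, 'b) monoid_scheme \<Rightarrow> ('c, 'd) monoid_scheme \<Rightarrow> ('a \<Rightarrow> 'c) \<Rightarrow> bool" where
  "monoid_homomorphism H D \<phi> \<longleftrightarrow> \<phi> \<in> hom H D \<and> \<phi> \<one>\<^bsub>H\<^esub> = \<one>\<^bsub>D\<^esub>"

definition divisor_homomorphism ::
  "('a, 'b) monoid_scheme \<Rightarrow> ('c, 'd) monoid_scheme \<Rightarrow> ('a \<Rightarrow> 'c) \<Rightarrow> bool" where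
  "divisor_homomorphism H D \<phi> \<longleftrightarrow> monoid_homomorphism H D \<phi> \<and>
     (\<forall>a \<in> carrier H. \<forall>b \<in> carrier H. \<phi> a divides\<^bsub>D\<^esub> \<phi> b \<longrightarrow> a divides\<^bsub>H\<^esub> b)"

definition cofinal_homomorphism ::
  "('a, 'b) monoid_scheme \<Rightarrow> ('c, 'd) monoid_scheme \<Rightarrow> ('a \<Rightarrow> 'c) \<Rightarrow> bool" where
  "cofinal_homomorphism H D \<phi> \<longleftrightarrow> monoid_homomorphism H D \<phi> \<and>
     (\<forall>\<alpha> \<in> carrier D. \<exists>a \<in> carrier H. \<alpha> divides\<^bsub>D\<^esub> \<phi> a)"

text \<open>
  Condition (WT2) is required for \<open>n \<ge> 1\<close>, whence \<open>vs \<noteq> []\<close>; for \<open>n = 0\<close> it would fail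
  whenever \<open>H\<close> has a unit other than the identity that is mapped to the identity.
\<close>

definition transfer_homomorphism ::
  "('a, 'b) monoid_scheme \<Rightarrow> ('c, 'd) monoid_scheme \<Rightarrow> ('a \<Rightarrow> 'c) \<Rightarrow> bool" where
  "transfer_homomorphism H B \<theta> \<longleftrightarrow>
     comm_monoid_cancel H \<and> atomic_monoid H \<and> comm_monoid_cancel B \<and> atomic_monoid B \<and>
     monoid_homomorphism H B \<theta> \<and>
     carrier B = Units B <#>\<^bsub>B\<^esub> (\<theta> ` carrier H) <#>\<^bsub>B\<^esub> Units B \<and>
     {a \<in> carrier H. \<theta> a \<in> Units B} = Units H \<and>
     (\<forall>a \<in> carrier H. \<forall>vs. vs \<noteq> [] \<and> set vs \<subseteq> atoms B \<and> factors B vs (\<theta> a) \<longrightarrow>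
        (\<exists>us \<tau>. length us = length vs \<and> set us \<subseteq> atoms H \<and> factors H us a \<and>
           \<tau> permutes {..<length vs} \<and>
           (\<forall>i < length vs. \<theta> (us ! i) \<in> Units B <#>\<^bsub>B\<^esub> {vs ! \<tau> i} <#>\<^bsub>B\<^esub> Units B)))"


section \<open>Free abelian monoids and zero-sum sequences\<close>

text \<open>
  The product of a finite multiset of elements; in the class group below, which is written
  multiplicatively here, this is the sum \<open>\<sigma>(S)\<close> of a sequence \<open>S\<close>.
\<close>

definition mset_prod :: "('a, 'b) monoid_scheme \<Rightarrow> 'a multiset \<Rightarrow> 'a" where
  "mset_prod G S = finprod G (\<lambda>g. g [^]\<^bsub>G\<^esub> count S g) (set_mset S)"

definition free_abelian_monoid :: "('a, 'b) monoid_scheme \<Rightarrow> 'a set \<Rightarrow> bool" where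
  "free_abelian_monoid F P \<longleftrightarrow> comm_monoid_cancel F \<and> P \<subseteq> carrier F \<and>
     (\<forall>x \<in> carrier F. \<exists>!S. set_mset S \<subseteq> P \<and> mset_prod F S = x)"

text \<open>The standard model: sequences over \<open>P\<close>, i.e.\ finite multisets, under concatenation.\<close>

definition sequence_monoid :: "'a set \<Rightarrow> 'a multiset monoid" where
  "sequence_monoid P = \<lparr>carrier = {S. set_mset S \<subseteq> P}, monoid.mult = (+), one = {#}\<rparr>"

definition zero_sum_monoid :: "('a, 'b) monoid_scheme \<Rightarrow> 'a set \<Rightarrow> 'a multiset monoid" where
  "zero_sum_monoid G G\<^sub>0 =
     (sequence_monoid G\<^sub>0)\<lparr>carrier := {S \<in> carrier (sequence_monoid G\<^sub>0). mset_prod G S = \<one>\<^bsub>G\<^esub>}\<rparr>"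


section \<open>Krull monoids\<close>

text \<open>
  The elements of \<open>H Mod Units H\<close> are the cosets \<open>a H\<^sup>\<times>\<close>, multiplied as sets.
\<close>

definition reduced_quotient :: "('a, 'b) monoid_scheme \<Rightarrow> 'a set monoid" where
  "reduced_quotient H = H Mod Units H"

text \<open>
  HOL cannot quantify over the type of the basis inside a definition. The type \<open>'a \<Rightarrow> nat\<close> is
  large enough: basis elements inducing the same valuation on \<open>H\<close> can be identified, so that the
  basis may be taken to consist of functions from \<open>H\<close> to the naturals. Lemma \<open>krull_monoidI\<close> below
  shows that a basis of any other type yields the same notion.
\<close>

definition krull_monoid :: "('a, 'b) monoid_scheme \<Rightarrow> bool" where
  "krull_monoid H \<longleftrightarrow> comm_monoid_cancel H \<and>
     (\<exists>(P :: ('a \<Rightarrow> nat) set) \<phi>.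
        divisor_homomorphism (reduced_quotient H) (sequence_monoid P) \<phi> \<and>
        inj_on \<phi> (carrier (reduced_quotient H)))"

lemma divides_sequence_monoid_iff:
  assumes "set_mset S \<subseteq> P" "set_mset T \<subseteq> P"
  shows "S divides\<^bsub>sequence_monoid P\<^esub> T \<longleftrightarrow> S \<subseteq># T"
proof
  assume "S \<subseteq># T"
  then have "T = S + (T - S)" by simp
  moreover have "set_mset (T - S) \<subseteq> P" using assms in_diffD by fastforce
  ultimately show "S divides\<^bsub>sequence_monoid P\<^esub> T"
    unfolding factor_def sequence_monoid_def by auto
qed (auto simp: factor_def sequence_monoid_def)

lemma krull_monoidI:
  fixes H :: "('a, 'b) monoid_scheme" and P :: "'p set" and \<phi> :: "'a set \<Rightarrow> 'p multiset"
  assumes H: "comm_monoid_cancel H"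
    and div: "divisor_homomorphism (reduced_quotient H) (sequence_monoid P) \<phi>"
    and inj: "inj_on \<phi> (carrier (reduced_quotient H))"
  shows "krull_monoid H"
proof -
  let ?R = "reduced_quotient H"
  define v where "v p = (\<lambda>a. count (\<phi> (Units H #>\<^bsub>H\<^esub> a)) p)" for p
  have carr: "carrier ?R = (\<lambda>a. Units H #>\<^bsub>H\<^esub> a) ` carrier H"
    by (simp add: reduced_quotient_def carrier_FactGroup)
  define r where "r p = (SOME q. q \<in> P \<and> v q = v p)" for p
  have r: "r p \<in> P \<and> v (r p) = v p" if "p \<in> P" for p
    unfolding r_def using someI[of "\<lambda>q. q \<in> P \<and> v q = v p" p] that by simp
  define Q where "Q = r ` P"
  have inj_v: "inj_on v Q"
  proof (rule inj_onI)
    fix x y assume "x \<in> Q" "y \<in> Q" and eq: "v x = v y"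
    then obtain p q where pq: "p \<in> P" "q \<in> P" "x = r p" "y = r q" by (auto simp: Q_def)
    then have "v p = v q" using eq r by simp
    then show "x = y" unfolding pq r_def by simp
  qed
  define \<psi> where "\<psi> X = image_mset v (filter_mset (\<lambda>p. p \<in> Q) (\<phi> X))" for X
  have cnt: "count (\<psi> X) (v q) = count (\<phi> X) q" if "q \<in> Q" for X q
  proof -
    have "count (\<psi> X) (v q) = (\<Sum>p | p \<in># filter_mset (\<lambda>p. p \<in> Q) (\<phi> X) \<and> v q = v p.
            count (filter_mset (\<lambda>p. p \<in> Q) (\<phi> X)) p)"
      unfolding \<psi>_def by (rule count_image_mset')
    also have "\<dots> = (\<Sum>p \<in> (if q \<in># \<phi> X then {q} else {}). count (\<phi> X) p)"
      using that by (intro sum.cong) (auto dest: inj_onD[OF inj_v] split: if_splits)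
    also have "\<dots> = count (\<phi> X) q"
      by (simp add: not_in_iff)
    finally show ?thesis .
  qed
  have phi_in: "set_mset (\<phi> X) \<subseteq> P" if "X \<in> carrier ?R" for X
    using div that
    by (auto simp: divisor_homomorphism_def monoid_homomorphism_def hom_def sequence_monoid_def)
  have sub: "\<phi> X \<subseteq># \<phi> Y" if X: "X \<in> carrier ?R" and Y: "Y \<in> carrier ?R" and le: "\<psi> X \<subseteq># \<psi> Y" for X Y
  proof (rule mset_subset_eqI)
    fix p
    show "count (\<phi> X) p \<le> count (\<phi> Y) p"
    proof (cases "p \<in> P")
      case True
      obtain a b where ab: "X = Units H #>\<^bsub>H\<^esub> a" "Y = Units H #>\<^bsub>H\<^esub> b"
        using X Y carr by auto
      have v_same: "v (r p) c = v p c" for c using r[OF True] by simp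
      have same: "count (\<phi> X) p = count (\<phi> X) (r p)" "count (\<phi> Y) p = count (\<phi> Y) (r p)"
        using v_same[of a] v_same[of b] by (simp_all add: v_def ab)
      have "r p \<in> Q" using True by (simp add: Q_def)
      then show ?thesis using le cnt same by (metis mset_subset_eq_count)
    next
      case False
      then have "p \<notin># \<phi> X" using phi_in[OF X] by auto
      then show ?thesis by (simp add: not_in_iff)
    qed
  qed
  have psi_in: "set_mset (\<psi> X) \<subseteq> v ` Q" for X by (auto simp: \<psi>_def)
  have "divisor_homomorphism ?R (sequence_monoid (v ` Q)) \<psi>"
    unfolding divisor_homomorphism_def
  proof (intro conjI ballI impI)
    show "monoid_homomorphism ?R (sequence_monoid (v ` Q)) \<psi>"
      using div psi_in
      by (auto simp: divisor_homomorphism_def monoid_homomorphism_def hom_def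
          sequence_monoid_def \<psi>_def)
  next
    fix X Y assume X: "X \<in> carrier ?R" and Y: "Y \<in> carrier ?R"
      and "\<psi> X divides\<^bsub>sequence_monoid (v ` Q)\<^esub> \<psi> Y"
    then have "\<phi> X \<subseteq># \<phi> Y"
      using sub by (simp add: divides_sequence_monoid_iff psi_in)
    then show "X divides\<^bsub>?R\<^esub> Y"
      using div X Y phi_in by (simp add: divisor_homomorphism_def divides_sequence_monoid_iff)
  qed
  moreover have "inj_on \<psi> (carrier ?R)"
    using sub inj by (intro inj_onI) (metis inj_onD subset_mset.antisym subset_mset.order_refl)
  ultimately show ?thesis
    unfolding krull_monoid_def using H by blast
qed


section \<open>Quotient groups and class groups\<close>

definition frac_rel :: "('a, 'b) monoid_scheme \<Rightarrow> (('a \<times> 'a) \<times> ('a \<times> 'a)) set" where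
  "frac_rel M = {((a, b), (c, d)). a \<in> carrier M \<and> b \<in> carrier M \<and> c \<in> carrier M \<and> d \<in> carrier M \<and>
     a \<otimes>\<^bsub>M\<^esub> d = c \<otimes>\<^bsub>M\<^esub> b}"

text \<open>The class of \<open>(a, b)\<close> is the fraction \<open>a b\<^sup>-\<^sup>1\<close>.\<close>

definition frac :: "('a, 'b) monoid_scheme \<Rightarrow> 'a \<Rightarrow> 'a \<Rightarrow> ('a \<times> 'a) set" where
  "frac M a b = frac_rel M `` {(a, b)}"

definition quotient_group :: "('a, 'b) monoid_scheme \<Rightarrow> ('a \<times> 'a) set monoid" where
  "quotient_group M =
     \<lparr>carrier = (carrier M \<times> carrier M) // frac_rel M,
      monoid.mult = (\<lambda>X Y. \<Union>(a, b) \<in> X. \<Union>(c, d) \<in> Y. frac M (a \<otimes>\<^bsub>M\<^esub> c) (b \<otimes>\<^bsub>M\<^esub> d)),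
      one = frac M \<one>\<^bsub>M\<^esub> \<one>\<^bsub>M\<^esub>\<rparr>"

text \<open>For a submonoid \<open>H\<close> of \<open>F\<close>: the quotient group of \<open>H\<close> as a subgroup of that of \<open>F\<close>.\<close>

definition quotient_subgroup :: "('a, 'b) monoid_scheme \<Rightarrow> 'a set \<Rightarrow> ('a \<times> 'a) set set" where
  "quotient_subgroup F H = {frac F a b | a b. a \<in> H \<and> b \<in> H}"

definition class_group :: "('a, 'b) monoid_scheme \<Rightarrow> 'a set \<Rightarrow> ('a \<times> 'a) set set monoid" where
  "class_group F H = quotient_group F Mod quotient_subgroup F H"

definition divisor_class :: "('a, 'b) monoid_scheme \<Rightarrow> 'a set \<Rightarrow> 'a \<Rightarrow> ('a \<times> 'a) set set" where
  "divisor_class F H a = quotient_subgroup F H #>\<^bsub>quotient_group F\<^esub> frac F a \<one>\<^bsub>F\<^esub>"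

lemma (in comm_monoid_cancel) equiv_frac_rel: "equiv (carrier G \<times> carrier G) (frac_rel G)"
proof (rule equivI)
  show "trans (frac_rel G)"
  proof (rule transI, clarsimp simp: frac_rel_def)
    fix a b c d e f
    assume c: "a \<in> carrier G" "b \<in> carrier G" "c \<in> carrier G" "d \<in> carrier G"
      "e \<in> carrier G" "f \<in> carrier G" and 1: "a \<otimes> d = c \<otimes> b" and 2: "c \<otimes> f = e \<otimes> d"
    have "(a \<otimes> f) \<otimes> d = (a \<otimes> d) \<otimes> f" using c by (simp add: m_ac)
    also have "\<dots> = (c \<otimes> f) \<otimes> b" using c 1 by (simp add: m_ac)
    also have "\<dots> = (e \<otimes> b) \<otimes> d" using c 2 by (simp add: m_ac)
    finally show "a \<otimes> f = e \<otimes> b" using c by (meson m_closed r_cancel)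
  qed
qed (auto simp: frac_rel_def refl_on_def sym_def)

lemma (in comm_monoid_cancel) frac_eq_iff:
  assumes "a \<in> carrier G" "b \<in> carrier G" "c \<in> carrier G" "d \<in> carrier G"
  shows "frac G a b = frac G c d \<longleftrightarrow> a \<otimes> d = c \<otimes> b"
  using assms eq_equiv_class_iff[OF equiv_frac_rel, of "(a, b)" "(c, d)"]
  by (simp add: frac_def frac_rel_def)

lemma (in comm_monoid_cancel) carrier_quotient_group:
  "carrier (quotient_group G) = {frac G a b | a b. a \<in> carrier G \<and> b \<in> carrier G}"
  by (auto simp: quotient_group_def quotient_def frac_def)

lemma (in comm_monoid_cancel) mult_quotient_group:
  assumes c: "a \<in> carrier G" "b \<in> carrier G" "c \<in> carrier G" "d \<in> carrier G"
  shows "frac G a b \<otimes>\<^bsub>quotient_group G\<^esub> frac G c d = frac G (a \<otimes> c) (b \<otimes> d)"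
proof -
  have key: "frac G (x \<otimes> z) (y \<otimes> w) = frac G (a \<otimes> c) (b \<otimes> d)"
    if "(x, y) \<in> frac G a b" "(z, w) \<in> frac G c d" for x y z w
  proof -
    have m: "x \<in> carrier G" "y \<in> carrier G" "z \<in> carrier G" "w \<in> carrier G"
      and e: "a \<otimes> y = x \<otimes> b" "c \<otimes> w = z \<otimes> d"
      using that by (auto simp: frac_def frac_rel_def)
    have "(x \<otimes> z) \<otimes> (b \<otimes> d) = (x \<otimes> b) \<otimes> (z \<otimes> d)" using m c by (simp add: m_ac)
    also have "\<dots> = (a \<otimes> y) \<otimes> (c \<otimes> w)" by (simp only: e)
    also have "\<dots> = (a \<otimes> c) \<otimes> (y \<otimes> w)" using m c by (simp add: m_ac)
    finally show ?thesis using m c by (simp add: frac_eq_iff)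
  qed
  have mem: "(a, b) \<in> frac G a b" "(c, d) \<in> frac G c d"
    using c by (auto simp: frac_def frac_rel_def)
  have "frac G a b \<otimes>\<^bsub>quotient_group G\<^esub> frac G c d =
      (\<Union>(x, y) \<in> frac G a b. \<Union>(z, w) \<in> frac G c d. frac G (x \<otimes> z) (y \<otimes> w))"
    by (simp add: quotient_group_def)
  also have "\<dots> = frac G (a \<otimes> c) (b \<otimes> d)"
  proof (intro equalityI subsetI)
    fix p assume "p \<in> (\<Union>(x, y) \<in> frac G a b. \<Union>(z, w) \<in> frac G c d. frac G (x \<otimes> z) (y \<otimes> w))"
    then obtain x y z w where "(x, y) \<in> frac G a b" "(z, w) \<in> frac G c d"
      "p \<in> frac G (x \<otimes> z) (y \<otimes> w)" by blast
    then show "p \<in> frac G (a \<otimes> c) (b \<otimes> d)" using key by blast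
  qed (use mem in blast)
  finally show ?thesis .
qed

lemma (in comm_monoid_cancel) comm_group_quotient_group: "comm_group (quotient_group G)"
proof (rule comm_groupI)
  let ?Q = "quotient_group G"
  have one: "\<one>\<^bsub>?Q\<^esub> = frac G \<one> \<one>" by (simp add: quotient_group_def)
  have ex: "\<exists>a b. a \<in> carrier G \<and> b \<in> carrier G \<and> X = frac G a b" if "X \<in> carrier ?Q" for X
    using that by (auto simp: carrier_quotient_group)
  have mem: "frac G a b \<in> carrier ?Q" if "a \<in> carrier G" "b \<in> carrier G" for a b
    using that by (auto simp: carrier_quotient_group)
  show "\<one>\<^bsub>?Q\<^esub> \<in> carrier ?Q" by (simp add: one mem)
  fix X assume X: "X \<in> carrier ?Q"
  obtain a b where ab: "a \<in> carrier G" "b \<in> carrier G" "X = frac G a b" using ex[OF X] by blast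
  show "\<one>\<^bsub>?Q\<^esub> \<otimes>\<^bsub>?Q\<^esub> X = X" using ab by (simp add: one mult_quotient_group)
  have "frac G b a \<otimes>\<^bsub>?Q\<^esub> X = \<one>\<^bsub>?Q\<^esub>"
    using ab by (simp add: one mult_quotient_group frac_eq_iff m_comm)
  then show "\<exists>Y\<in>carrier ?Q. Y \<otimes>\<^bsub>?Q\<^esub> X = \<one>\<^bsub>?Q\<^esub>" using ab mem by blast
  fix Y assume Y: "Y \<in> carrier ?Q"
  obtain c d where cd: "c \<in> carrier G" "d \<in> carrier G" "Y = frac G c d" using ex[OF Y] by blast
  show "X \<otimes>\<^bsub>?Q\<^esub> Y \<in> carrier ?Q" using ab cd by (simp add: mult_quotient_group mem)
  show "X \<otimes>\<^bsub>?Q\<^esub> Y = Y \<otimes>\<^bsub>?Q\<^esub> X" using ab cd by (simp add: mult_quotient_group m_comm)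
  fix Z assume Z: "Z \<in> carrier ?Q"
  obtain e f where "e \<in> carrier G" "f \<in> carrier G" "Z = frac G e f" using ex[OF Z] by blast
  then show "X \<otimes>\<^bsub>?Q\<^esub> Y \<otimes>\<^bsub>?Q\<^esub> Z = X \<otimes>\<^bsub>?Q\<^esub> (Y \<otimes>\<^bsub>?Q\<^esub> Z)"
    using ab cd by (simp add: mult_quotient_group m_assoc)
qed

lemma (in comm_monoid_cancel) subgroup_quotient_subgroup:
  assumes "submonoid H G"
  shows "subgroup (quotient_subgroup G H) (quotient_group G)"
proof -
  interpret Q: comm_group "quotient_group G" by (rule comm_group_quotient_group)
  have sub: "x \<in> carrier G" if "x \<in> H" for x using assms that submonoid.mem_carrier by metis
  show ?thesis
  proof (rule Q.subgroupI)
    show "quotient_subgroup G H \<subseteq> carrier (quotient_group G)"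
      using sub by (auto simp: quotient_subgroup_def carrier_quotient_group)
    show "quotient_subgroup G H \<noteq> {}"
      using submonoid.one_closed[OF assms] by (auto simp: quotient_subgroup_def)
  next
    fix X assume "X \<in> quotient_subgroup G H"
    then obtain a b where ab: "a \<in> H" "b \<in> H" "X = frac G a b"
      by (auto simp: quotient_subgroup_def)
    have "frac G b a \<otimes>\<^bsub>quotient_group G\<^esub> X = \<one>\<^bsub>quotient_group G\<^esub>"
      using ab sub
      by (simp add: mult_quotient_group) (simp add: quotient_group_def frac_eq_iff m_comm)
    then have "inv\<^bsub>quotient_group G\<^esub> X = frac G b a"
      using ab sub by (intro Q.inv_equality) (auto simp: carrier_quotient_group)
    then show "inv\<^bsub>quotient_group G\<^esub> X \<in> quotient_subgroup G H"
      using ab by (auto simp: quotient_subgroup_def)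
  next
    fix X Y assume "X \<in> quotient_subgroup G H" "Y \<in> quotient_subgroup G H"
    then obtain a b c d where "a \<in> H" "b \<in> H" "X = frac G a b" "c \<in> H" "d \<in> H" "Y = frac G c d"
      by (auto simp: quotient_subgroup_def)
    then show "X \<otimes>\<^bsub>quotient_group G\<^esub> Y \<in> quotient_subgroup G H"
      using submonoid.m_closed[OF assms] sub
      by (auto simp: mult_quotient_group quotient_subgroup_def)
  qed
qed

lemma (in comm_monoid_cancel) comm_group_class_group:
  assumes "submonoid H G"
  shows "comm_group (class_group G H)"
  unfolding class_group_def
  using comm_group.abelian_FactGroup[OF comm_group_quotient_group subgroup_quotient_subgroup[OF assms]] .

end

(*
  Every a in H has a unique factorization T over P in F, and \<beta> replaces each prime in T by its class.
  A divisor homomorphism satisfies H = F \<inter> q(H), so a product of primes lies in H if and only if the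
  sequence of their classes has sum zero. Hence any way of splitting \<beta>(a) into zero-sum sequences
  lifts to a splitting of T into sequences whose products again lie in H.
*)
theory Submission
  imports Defs
begin

section \<open>Transfer homomorphisms preserve sets of lengths\<close>

lemma (in comm_monoid_cancel) unit_mult_atom:
  assumes e: "e \<in> Units G" and a: "a \<in> atoms G"
  shows "e \<otimes> a \<in> atoms G"
proof -
  have ac: "a \<in> carrier G" "irreducible G a" using a by (auto simp: atoms_def)
  have "a \<otimes> e \<sim> a"
    using ac e by (intro associatedI2[of e]) auto
  then have "irreducible G (a \<otimes> e)"
    using ac e by (meson Units_closed associated_sym irreducible_cong m_closed)
  then show ?thesis
    using ac m_comm[OF ac(1) Units_closed[OF e]] Units_closed[OF e] by (simp add: atoms_def)
qed

lemma (in comm_monoid_cancel) factors_nonempty: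
  assumes "factors G vs a" "a \<notin> Units G"
  shows "vs \<noteq> []"
  using assms by (auto simp: factors_def)

text \<open>A factorization of a non-unit has a first atom, and that atom can absorb
  \<open>e\<close> without changing the length. If \<open>a\<close> is a unit, both sets are
  \<open>{0}\<close>.\<close>

lemma (in comm_monoid_cancel) set_of_lengths_unit_mult_subset:
  assumes e: "e \<in> Units G" and a: "a \<in> carrier G"
  shows "set_of_lengths G a \<subseteq> set_of_lengths G (e \<otimes> a)"
proof (cases "a \<in> Units G")
  case True
  then show ?thesis using e by (simp add: set_of_lengths_def)
next
  case False
  then have nu: "e \<otimes> a \<notin> Units G"
    using e a by (metis Units_closed m_comm prod_unit_r)
  show ?thesis
  proof
    fix n assume "n \<in> set_of_lengths G a"
    then obtain us where us: "set us \<subseteq> atoms G" "factors G us a" "n = length us"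
      using False by (auto simp: set_of_lengths_def)
    then obtain v vs where v: "us = v # vs" using factors_nonempty False by (cases us) auto
    have c: "set us \<subseteq> carrier G" using us by (auto simp: atoms_def)
    have "factors G (e \<otimes> v # vs) (e \<otimes> a)"
      using us v unit_mult_atom[OF e, of v] e c
      by (auto simp: factors_def atoms_def m_assoc)
    moreover have "set (e \<otimes> v # vs) \<subseteq> atoms G" using us v unit_mult_atom[OF e] by auto
    ultimately show "n \<in> set_of_lengths G (e \<otimes> a)"
      using nu us v unfolding set_of_lengths_def by (auto intro!: exI[of _ "e \<otimes> v # vs"])
  qed
qed

lemma (in comm_monoid_cancel) set_of_lengths_unit_mult:
  assumes e: "e \<in> Units G" and a: "a \<in> carrier G"
  shows "set_of_lengths G (e \<otimes> a) = set_of_lengths G a"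
proof
  \<comment> \<open>Multiplication by \<open>inv e\<close> undoes multiplication by
    \<open>e\<close>, so the inclusion already proved, applied to \<open>inv e\<close>, gives the
    reverse one.\<close>
  have "inv e \<otimes> (e \<otimes> a) = a" 
    using e a m_assoc[OF Units_inv_closed[OF e] Units_closed[OF e] a] by simp
  then show "set_of_lengths G (e \<otimes> a) \<subseteq> set_of_lengths G a"
    using set_of_lengths_unit_mult_subset[of "inv e" "e \<otimes> a"] e a Units_closed[OF e] by simp
qed (rule set_of_lengths_unit_mult_subset[OF assms])

text \<open>Split off the first factor \<open>v\<close>. Since \<open>a\<close> is an atom and
  \<open>v\<close> is not a unit, the product of the remaining factors is a unit; a unit has no atom
  as a factor, so nothing remains.\<close>

lemma (in comm_monoid_cancel) factors_atom_length:
  assumes a: "a \<in> atoms G" and us: "set us \<subseteq> atoms G" "factors G us a"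
  shows "length us = 1"
proof -
  have nu: "a \<notin> Units G" using a by (simp add: mem_atoms_iff)
  obtain v vs where v: "us = v # vs" using factors_nonempty[OF us(2) nu] by (cases us) auto
  have c: "set vs \<subseteq> carrier G" "v \<in> carrier G" and vu: "v \<notin> Units G"
    using us v by (auto simp: mem_atoms_iff)
  let ?w = "foldr (\<otimes>) vs \<one>"
  have w: "?w \<in> carrier G" using c by simp
  have "a = v \<otimes> ?w" using us v by (simp add: factors_def)
  then have wu: "?w \<in> Units G" using a c w vu by (auto simp: mem_atoms_iff)
  have "vs = []"
  proof (cases vs)
    case (Cons x xs)
    then have "x \<in> carrier G" "foldr (\<otimes>) xs \<one> \<in> carrier G" "x \<notin> Units G"
      using c us v by (auto simp: mem_atoms_iff)
    then show ?thesis using wu Cons unit_factor[of x "foldr (\<otimes>) xs \<one>"] by simp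
  qed
  then show ?thesis using v by simp
qed

section \<open>Lengths along a transfer homomorphism\<close>

lemma foldr_mult_hom:
  assumes "monoid H" "monoid_homomorphism H B \<theta>" "set us \<subseteq> carrier H"
  shows "foldr (\<otimes>\<^bsub>B\<^esub>) (map \<theta> us) \<one>\<^bsub>B\<^esub> = \<theta> (foldr (\<otimes>\<^bsub>H\<^esub>) us \<one>\<^bsub>H\<^esub>)"
  using assms(3)
  by (induction us)
    (use assms(1,2) in \<open>auto simp: monoid_homomorphism_def hom_def monoid.multlist_closed\<close>)

text \<open>Atomicity of \<open>B\<close> provides a factorization of \<open>\<theta> u\<close>, and
  (WT2) lifts it to a factorization of \<open>u\<close> of the same length. That length is 1 because
  \<open>u\<close> is an atom, so \<open>\<theta> u\<close> is itself the single atom of its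
  factorization.\<close>

lemma transfer_homomorphism_atom:
  assumes t: "transfer_homomorphism H B \<theta>" and u: "u \<in> atoms H"
  shows "\<theta> u \<in> atoms B"
proof -
  interpret H: comm_monoid_cancel H using t by (simp add: transfer_homomorphism_def)
  interpret B: comm_monoid_cancel B using t by (simp add: transfer_homomorphism_def)
  have uc: "u \<in> carrier H" "u \<notin> Units H" using u by (auto simp: H.mem_atoms_iff)
  have nu: "\<theta> u \<in> carrier B - Units B"
    using t uc by (auto simp: transfer_homomorphism_def monoid_homomorphism_def hom_def)
  then obtain vs where vs: "set vs \<subseteq> atoms B" "factors B vs (\<theta> u)"
    using t unfolding transfer_homomorphism_def atomic_monoid_def by meson
  then have "vs \<noteq> []" using B.factors_nonempty nu by auto
  then obtain us where us: "length us = length vs" "set us \<subseteq> atoms H" "factors H us u"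
    using t vs uc unfolding transfer_homomorphism_def by blast
  then obtain v where "vs = [v]" using H.factors_atom_length[OF u]
    by (metis One_nat_def Suc_length_conv length_0_conv)
  then have "\<theta> u = v" using vs by (auto simp: factors_def atoms_def)
  then show ?thesis using vs \<open>vs = [v]\<close> by simp
qed

text \<open>For a non-unit \<open>a\<close>, (WT2) lifts factorizations of \<open>\<theta> a\<close>
  to factorizations of \<open>a\<close> of equal length; conversely \<open>\<theta>\<close> maps
  atoms to atoms, so factorizations of \<open>a\<close> can be pushed forward.\<close>

lemma transfer_homomorphism_set_of_lengths:
  assumes t: "transfer_homomorphism H B \<theta>" and a: "a \<in> carrier H"
  shows "set_of_lengths B (\<theta> a) = set_of_lengths H a"
proof (cases "a \<in> Units H")
  case True
  then have "\<theta> a \<in> Units B" using t by (auto simp: transfer_homomorphism_def)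
  then show ?thesis using True by (simp add: set_of_lengths_def)
next
  case False
  interpret H: comm_monoid_cancel H using t by (simp add: transfer_homomorphism_def)
  interpret B: comm_monoid_cancel B using t by (simp add: transfer_homomorphism_def)
  have nu: "\<theta> a \<notin> Units B" using t a False by (auto simp: transfer_homomorphism_def)
  have "\<exists>us. n = length us \<and> set us \<subseteq> atoms H \<and> factors H us a"
    if "set vs \<subseteq> atoms B" "factors B vs (\<theta> a)" "n = length vs" for n vs
  proof -
    \<comment> \<open>(WT2) speaks of nonempty factorizations only; here \<open>\<theta> a\<close>
      is not a unit.\<close>
    have "vs \<noteq> []" using B.factors_nonempty that nu by auto
    then show ?thesis using t a that unfolding transfer_homomorphism_def by metis
  qed
  moreover have "set (map \<theta> us) \<subseteq> atoms B \<and> factors B (map \<theta> us) (\<theta> a)"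
    if us: "set us \<subseteq> atoms H" "factors H us a" for us
  proof -
    have "set (map \<theta> us) \<subseteq> atoms B" using us transfer_homomorphism_atom[OF t] by auto
    moreover have "foldr (\<otimes>\<^bsub>B\<^esub>) (map \<theta> us) \<one>\<^bsub>B\<^esub> = \<theta> a"
      using us t foldr_mult_hom[of H B \<theta> us] H.monoid_axioms
      by (auto simp: factors_def atoms_def transfer_homomorphism_def)
    ultimately show ?thesis by (auto simp: factors_def atoms_def)
  qed
  then have "\<exists>vs. n = length vs \<and> set vs \<subseteq> atoms B \<and> factors B vs (\<theta> a)"
    if "set us \<subseteq> atoms H" "factors H us a" "n = length us" for n us
    using that by (metis length_map)
  ultimately show ?thesis using False nu unfolding set_of_lengths_def by auto
qed

lemma transfer_homomorphism_system_of_lengths: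
  assumes t: "transfer_homomorphism H B \<theta>"
  shows "system_of_lengths H = system_of_lengths B"
proof -
  interpret B: comm_monoid_cancel B using t by (simp add: transfer_homomorphism_def)
  have cl: "\<theta> a \<in> carrier B" if "a \<in> carrier H" for a
    using t that by (auto simp: transfer_homomorphism_def monoid_homomorphism_def hom_def)
  have "\<exists>a \<in> carrier H. set_of_lengths B b = set_of_lengths H a" if b: "b \<in> carrier B" for b
  proof -
    have "b \<in> Units B <#>\<^bsub>B\<^esub> (\<theta> ` carrier H) <#>\<^bsub>B\<^esub> Units B"
      using t b by (simp add: transfer_homomorphism_def)
    then obtain e f a where e: "e \<in> Units B" "f \<in> Units B" "a \<in> carrier H"
      "b = e \<otimes>\<^bsub>B\<^esub> \<theta> a \<otimes>\<^bsub>B\<^esub> f"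
      by (auto simp: set_mult_def)
    \<comment> \<open>By (T1), \<open>b\<close> differs from an image \<open>\<theta> a\<close> only
      by units; collecting them into one unit shows that \<open>b\<close> and
      \<open>\<theta> a\<close> have the same lengths.\<close>
    then have "b = (e \<otimes>\<^bsub>B\<^esub> f) \<otimes>\<^bsub>B\<^esub> \<theta> a"
      using cl[OF e(3)] B.Units_closed[OF e(1)] B.Units_closed[OF e(2)] by (simp add: B.m_ac)
    then have "set_of_lengths B b = set_of_lengths H a"
      using e cl B.set_of_lengths_unit_mult[of "e \<otimes>\<^bsub>B\<^esub> f" "\<theta> a"]
        transfer_homomorphism_set_of_lengths[OF t] by simp
    then show ?thesis using e by blast
  qed
  then show ?thesis
    using transfer_homomorphism_set_of_lengths[OF t] cl
    unfolding system_of_lengths_def by (auto simp: image_iff) metis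
qed


section \<open>Products of multisets and zero-sum sequences\<close>

text \<open>Elements outside the support contribute the factor \<open>g [^] 0\<close>, which is
  \<open>\<one>\<close>. This allows two multisets to be compared over a common index set.\<close>

lemma (in comm_monoid) mset_prod_eq_finprod:
  assumes "finite A" "set_mset S \<subseteq> A" "A \<subseteq> carrier G"
  shows "mset_prod G S = finprod G (\<lambda>g. g [^] count S g) A"
  unfolding mset_prod_def
  by (rule finprod_mono_neutral_cong_left) (use assms in \<open>auto simp: not_in_iff\<close>)

lemma (in comm_monoid) mset_prod_closed [simp, intro]:
  assumes "set_mset S \<subseteq> carrier G"
  shows "mset_prod G S \<in> carrier G"
  unfolding mset_prod_def by (rule finprod_closed) (use assms in auto)

lemma (in comm_monoid) mset_prod_empty [simp]: "mset_prod G {#} = \<one>"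
  by (simp add: mset_prod_def)

lemma (in comm_monoid) mset_prod_single [simp]:
  assumes "x \<in> carrier G"
  shows "mset_prod G {#x#} = x"
  using assms by (simp add: mset_prod_def)

lemma (in comm_monoid) mset_prod_union [simp]:
  assumes "set_mset S \<subseteq> carrier G" "set_mset T \<subseteq> carrier G"
  shows "mset_prod G (S + T) = mset_prod G S \<otimes> mset_prod G T"
proof -
  let ?A = "set_mset S \<union> set_mset T"
  have "mset_prod G (S + T) = finprod G (\<lambda>g. g [^] count S g \<otimes> g [^] count T g) ?A"
    using assms mset_prod_eq_finprod[of ?A "S + T"]
    by (auto simp: nat_pow_mult intro!: finprod_cong')
  also have "\<dots> = finprod G (\<lambda>g. g [^] count S g) ?A \<otimes> finprod G (\<lambda>g. g [^] count T g) ?A"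
    using assms by (intro finprod_multf) auto
  finally show ?thesis
    using assms mset_prod_eq_finprod[of ?A S] mset_prod_eq_finprod[of ?A T] by simp
qed

text \<open>As \<open>h\<close> may identify elements, multiplicities can merge in the image;
  induction on \<open>T\<close> avoids counting over fibres. For the class map this will say that
  the sum of the classes is the class of the product.\<close>

lemma mset_prod_image_hom:
  assumes "comm_monoid M" "comm_monoid K" "monoid_homomorphism M K h" "set_mset T \<subseteq> carrier M"
  shows "mset_prod K (image_mset h T) = h (mset_prod M T)"
proof -
  interpret M: comm_monoid M by fact
  interpret K: comm_monoid K by fact
  have h: "h \<in> hom M K" "h \<one>\<^bsub>M\<^esub> = \<one>\<^bsub>K\<^esub>" using assms(3) by (auto simp: monoid_homomorphism_def)
  show ?thesis using assms(4)
  proof (induction T)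
    case (add x T)
    have "set_mset (image_mset h T) \<subseteq> carrier K" "h x \<in> carrier K"
      using h add.prems by (auto simp: hom_def)
    then show ?case
      using add h M.mset_prod_union[of "{#x#}" T] K.mset_prod_union[of "{#h x#}" "image_mset h T"]
      by (simp add: hom_mult)
  qed (simp add: h)
qed

section \<open>The monoid of zero-sum sequences, and lifting multisets along a map\<close>

lemma zero_sum_monoid_simps [simp]:
  "S \<in> carrier (zero_sum_monoid G G\<^sub>0) \<longleftrightarrow> set_mset S \<subseteq> G\<^sub>0 \<and> mset_prod G S = \<one>\<^bsub>G\<^esub>"
  "S \<otimes>\<^bsub>zero_sum_monoid G G\<^sub>0\<^esub> T = S + T"
  "\<one>\<^bsub>zero_sum_monoid G G\<^sub>0\<^esub> = {#}"
  by (auto simp: zero_sum_monoid_def sequence_monoid_def)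

lemma (in comm_monoid) comm_monoid_cancel_zero_sum_monoid:
  assumes "G\<^sub>0 \<subseteq> carrier G"
  shows "comm_monoid_cancel (zero_sum_monoid G G\<^sub>0)"
proof -
  have "set_mset S \<subseteq> carrier G" if "set_mset S \<subseteq> G\<^sub>0" for S using that assms by blast
  then show ?thesis
    by (intro monoid_cancel.intro comm_monoid_cancelI comm_monoidI)
      (auto simp: ac_simps)
qed

lemma (in comm_monoid) Units_zero_sum_monoid: "Units (zero_sum_monoid G G\<^sub>0) = {{#}}"
  by (auto simp: Units_def)

text \<open>Induction on the length of the sequence: since \<open>{#}\<close> is the only unit, a
  nonempty sequence that is not an atom splits into two strictly shorter nonempty zero-sum
  sequences.\<close>

lemma (in comm_monoid) atomic_zero_sum_monoid:
  assumes "G\<^sub>0 \<subseteq> carrier G"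
  shows "atomic_monoid (zero_sum_monoid G G\<^sub>0)"
proof -
  let ?B = "zero_sum_monoid G G\<^sub>0"
  interpret B: comm_monoid_cancel ?B by (rule comm_monoid_cancel_zero_sum_monoid[OF assms])
  have "\<exists>us. set us \<subseteq> atoms ?B \<and> factors ?B us S" if "S \<in> carrier ?B" "S \<noteq> {#}" for S
    using that
  proof (induction "size S" arbitrary: S rule: less_induct)
    case less
    show ?case
    proof (cases "S \<in> atoms ?B")
      case True
      then have "set [S] \<subseteq> atoms ?B \<and> factors ?B [S] S"
        by (auto simp: factors_def atoms_def)
      then show ?thesis by blast
    next
      case False
      then obtain U V where UV: "U \<in> carrier ?B" "V \<in> carrier ?B" "S = U + V" "U \<noteq> {#}" "V \<noteq> {#}"
        using less.prems unfolding B.mem_atoms_iff Units_zero_sum_monoid zero_sum_monoid_simps(2)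
        by blast
      then have "size U < size S" "size V < size S" by (auto simp: nonempty_has_size)
      then obtain us vs where u: "set us \<subseteq> atoms ?B" "factors ?B us U"
        "set vs \<subseteq> atoms ?B" "factors ?B vs V"
        using less.hyps UV by meson
      then have "factors ?B (us @ vs) S"
        using B.factors_mult[of us U vs V] UV(3) unfolding atoms_def
        by (auto simp del: zero_sum_monoid_simps(1))
      then show ?thesis using u by (intro exI[of _ "us @ vs"]) simp
    qed
  qed
  then show ?thesis unfolding atomic_monoid_def by (auto simp: Units_zero_sum_monoid)
qed

text \<open>\<open>image_mset f\<close> only relabels the occurrences in \<open>T\<close>, so
  cutting the image into pieces cuts \<open>T\<close> into corresponding pieces. The induction peels
  off one piece at a time; the order of the pieces is kept.\<close>

lemma image_mset_eq_foldr_plusD: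
  assumes "image_mset f T = foldr (+) vs {#}"
  shows "\<exists>Ts. map (image_mset f) Ts = vs \<and> foldr (+) Ts {#} = T"
  using assms
proof (induction vs arbitrary: T)
  case (Cons v vs)
  then obtain U V where UV: "T = U + V" "image_mset f U = v" "image_mset f V = foldr (+) vs {#}"
    by (metis foldr_Cons comp_apply image_mset_eq_plusD)
  obtain Ts where "map (image_mset f) Ts = vs" "foldr (+) Ts {#} = V" using Cons.IH[OF UV(3)] by blast
  then show ?case using UV by (intro exI[of _ "U # Ts"]) simp
qed simp

lemma exists_image_mset:
  assumes "set_mset S \<subseteq> f ` P"
  shows "\<exists>T. set_mset T \<subseteq> P \<and> image_mset f T = S"
proof (intro exI conjI)
  show "set_mset (image_mset (inv_into P f) S) \<subseteq> P"
    using assms by (auto intro!: inv_into_into)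
  show "image_mset f (image_mset (inv_into P f) S) = S"
    using assms by (auto simp: multiset.map_comp f_inv_into_f subset_iff intro!: multiset.map_ident_strong)
qed


section \<open>Classes of divisors\<close>

text \<open>The class map is the composite of the embedding
  \<open>a \<mapsto> frac G a \<one>\<close> into the quotient group and the canonical projection
  onto the factor group.\<close>

lemma (in comm_monoid_cancel) divisor_class_hom:
  assumes "submonoid H G"
  shows "monoid_homomorphism G (class_group G H) (divisor_class G H)"
proof -
  let ?Q = "quotient_group G" and ?N = "quotient_subgroup G H"
  interpret Q: comm_group ?Q by (rule comm_group_quotient_group)
  have sg: "subgroup ?N ?Q" by (rule subgroup_quotient_subgroup[OF assms])
  interpret N: normal ?N ?Q using Q.normal_iff_subgroup sg by simp
  have c: "frac G a \<one> \<in> carrier ?Q" if "a \<in> carrier G" for a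
    using that by (auto simp: carrier_quotient_group)
  have "frac G \<one> \<one> = \<one>\<^bsub>?Q\<^esub>" by (simp add: quotient_group_def)
  then show ?thesis
    using c Q.rcosetsI[OF N.subset] N.rcos_sum mult_quotient_group[of _ \<one> _ \<one>]
    by (auto simp: monoid_homomorphism_def hom_def class_group_def divisor_class_def FactGroup_def
        Q.coset_mult_one N.subset)
qed

text \<open>This is where the divisor homomorphism enters: it says that \<open>q(H) \<inter> F = H\<close>.\<close>

lemma (in comm_monoid_cancel) divisor_class_eq_one_iff:
  assumes H: "submonoid H G"
    and div: "divisor_homomorphism (G\<lparr>carrier := H\<rparr>) G (\<lambda>a. a)"
    and a: "a \<in> carrier G"
  shows "divisor_class G H a = \<one>\<^bsub>class_group G H\<^esub> \<longleftrightarrow> a \<in> H"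
proof -
  let ?Q = "quotient_group G" and ?N = "quotient_subgroup G H"
  interpret Q: comm_group ?Q by (rule comm_group_quotient_group)
  have sg: "subgroup ?N ?Q" by (rule subgroup_quotient_subgroup[OF H])
  have sub: "x \<in> carrier G" if "x \<in> H" for x using H that submonoid.mem_carrier by metis
  have c: "frac G a \<one> \<in> carrier ?Q" using a by (auto simp: carrier_quotient_group)
  \<comment> \<open>A coset is the identity of the factor group exactly when its representative lies
    in the subgroup.\<close>
  have "divisor_class G H a = \<one>\<^bsub>class_group G H\<^esub> \<longleftrightarrow> frac G a \<one> \<in> ?N"
    using Q.coset_join1[OF _ c sg] Q.coset_join2[OF c sg] subgroup.subset[OF sg]
    by (auto simp: divisor_class_def class_group_def FactGroup_def)
  also have "\<dots> \<longleftrightarrow> a \<in> H"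
  proof
    assume "a \<in> H"
    then show "frac G a \<one> \<in> ?N"
      using submonoid.one_closed[OF H] by (auto simp: quotient_subgroup_def)
  next
    assume "frac G a \<one> \<in> ?N"
    then obtain b d where bd: "b \<in> H" "d \<in> H" "frac G a \<one> = frac G b d"
      by (auto simp: quotient_subgroup_def)
    \<comment> \<open>Thus \<open>a\<close> is the cofactor of \<open>d\<close> in \<open>b\<close>.
      The divisor property yields a cofactor in \<open>H\<close>, and cancellation identifies the
      two.\<close>
    then have eq: "a \<otimes> d = b" using a sub by (simp add: frac_eq_iff)
    then have "d divides b" using a bd sub by (auto simp: factor_def m_comm)
    then have "d divides\<^bsub>G\<lparr>carrier := H\<rparr>\<^esub> b"
      using div bd by (simp add: divisor_homomorphism_def)
    then obtain x where x: "x \<in> H" "b = d \<otimes> x"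
      by (auto simp: factor_def)
    then have "a = x" using eq a bd sub by (metis m_comm r_cancel)
    then show "a \<in> H" using x by simp
  qed
  finally show ?thesis .
qed


section \<open>The block homomorphism\<close>

locale free_abelian_divisor_submonoid = comm_monoid_cancel F
  for F :: "('f, 'r) monoid_scheme" (structure) and P H :: "'f set" +
  assumes free: "free_abelian_monoid F P"
    and submonoid: "submonoid H F"
    and divisor: "divisor_homomorphism (F\<lparr>carrier := H\<rparr>) F (\<lambda>a. a)"
begin

abbreviation "cls \<equiv> divisor_class F H"
abbreviation "B \<equiv> zero_sum_monoid (class_group F H) (cls ` P)"
abbreviation "HM \<equiv> F\<lparr>carrier := H\<rparr>"

text \<open>Freeness makes the description unique for \<open>a\<close> in \<open>carrier F\<close>;
  elsewhere the value is unspecified.\<close>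

definition prime_factorization_mset :: "'f \<Rightarrow> 'f multiset" where
  "prime_factorization_mset a = (THE T. set_mset T \<subseteq> P \<and> mset_prod F T = a)"

abbreviation "pf \<equiv> prime_factorization_mset"

text \<open>Formed for every element of \<open>F\<close>, so that additivity can be proved there;
  for \<open>a\<close> in \<open>carrier F\<close> the value lies in \<open>B\<close> exactly when
  \<open>a\<close> lies in \<open>H\<close>.\<close>

definition block :: "'f \<Rightarrow> ('f \<times> 'f) set set multiset" where
  "block a = image_mset cls (pf a)"

section \<open>Unique factorization in \<open>F\<close> and additivity of
  \<open>block\<close>\<close>

lemma P_carrier: "P \<subseteq> carrier F"
  using free by (simp add: free_abelian_monoid_def)

lemma H_carrier: "x \<in> H \<Longrightarrow> x \<in> carrier F"
  using submonoid submonoid.mem_carrier by metis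

lemma mset_prod_P_closed: "set_mset T \<subseteq> P \<Longrightarrow> mset_prod F T \<in> carrier F"
  using P_carrier by (meson mset_prod_closed subset_trans)

lemma mset_prod_P_plus:
  "set_mset S \<subseteq> P \<Longrightarrow> set_mset T \<subseteq> P \<Longrightarrow> mset_prod F (S + T) = mset_prod F S \<otimes> mset_prod F T"
  using P_carrier by (meson mset_prod_union subset_trans)

lemma pf:
  assumes "a \<in> carrier F"
  shows "set_mset (pf a) \<subseteq> P" "mset_prod F (pf a) = a"
proof -
  have "\<exists>!T. set_mset T \<subseteq> P \<and> mset_prod F T = a"
    using free assms by (simp add: free_abelian_monoid_def)
  from theI'[OF this] show "set_mset (pf a) \<subseteq> P" "mset_prod F (pf a) = a"
    by (auto simp: prime_factorization_mset_def)
qed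

lemma pf_mset_prod:
  assumes "set_mset T \<subseteq> P"
  shows "pf (mset_prod F T) = T"
proof -
  have "\<exists>!T'. set_mset T' \<subseteq> P \<and> mset_prod F T' = mset_prod F T"
    using free mset_prod_P_closed[OF assms] by (simp add: free_abelian_monoid_def)
  then show ?thesis using assms pf[OF mset_prod_P_closed[OF assms]] by blast
qed

lemma pf_one: "pf \<one> = {#}"
  using pf_mset_prod[of "{#}"] by simp

lemma pf_mult:
  assumes "a \<in> carrier F" "b \<in> carrier F"
  shows "pf (a \<otimes> b) = pf a + pf b"
  using pf_mset_prod[of "pf a + pf b"] pf[OF assms(1)] pf[OF assms(2)]
  by (simp add: mset_prod_P_plus)

lemma block_mset_prod: "set_mset T \<subseteq> P \<Longrightarrow> block (mset_prod F T) = image_mset cls T"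
  by (simp add: block_def pf_mset_prod)

lemma block_mult:
  "a \<in> carrier F \<Longrightarrow> b \<in> carrier F \<Longrightarrow> block (a \<otimes> b) = block a + block b"
  by (simp add: block_def pf_mult)

lemma block_eq_empty_iff: "a \<in> carrier F \<Longrightarrow> block a = {#} \<longleftrightarrow> a = \<one>"
  using pf(2)[of a] by (auto simp: block_def pf_one)

section \<open>Membership in \<open>H\<close> read off from classes, and the structure of
  \<open>B\<close>\<close>

lemma comm_group_class: "comm_group (class_group F H)"
  by (rule comm_group_class_group[OF submonoid])

text \<open>The sum of the classes of the primes in \<open>T\<close> is the class of their product,
  and this class is trivial precisely for elements of \<open>H\<close>.\<close>

lemma mset_prod_mem_iff:
  assumes "set_mset T \<subseteq> P"
  shows "image_mset cls T \<in> carrier B \<longleftrightarrow> mset_prod F T \<in> H"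
proof -
  have "mset_prod (class_group F H) (image_mset cls T) = cls (mset_prod F T)"
    using assms P_carrier comm_group_class
    by (intro mset_prod_image_hom divisor_class_hom submonoid comm_monoid_axioms)
      (auto simp: comm_group.axioms)
  then show ?thesis
    using divisor_class_eq_one_iff[OF submonoid divisor mset_prod_P_closed[OF assms]] assms
    by auto
qed

lemma block_mem:
  assumes "a \<in> H"
  shows "block a \<in> carrier B"
  using mset_prod_mem_iff pf[OF H_carrier[OF assms]] assms by (simp add: block_def)

lemma cls_P: "cls ` P \<subseteq> carrier (class_group F H)"
  using divisor_class_hom[OF submonoid] P_carrier by (auto simp: monoid_homomorphism_def hom_def)

lemma comm_monoid_cancel_B: "comm_monoid_cancel B"
proof -
  interpret C: comm_group "class_group F H" by (rule comm_group_class)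
  show ?thesis by (rule C.comm_monoid_cancel_zero_sum_monoid[OF cls_P])
qed

lemma atomic_B: "atomic_monoid B"
proof -
  interpret C: comm_group "class_group F H" by (rule comm_group_class)
  show ?thesis by (rule C.atomic_zero_sum_monoid[OF cls_P])
qed

lemma Units_B: "Units B = {{#}}"
proof -
  interpret C: comm_group "class_group F H" by (rule comm_group_class)
  show ?thesis by (rule C.Units_zero_sum_monoid)
qed

section \<open>The monoid \<open>HM\<close> and the lifting of factorizations from
  \<open>B\<close>\<close>

lemma comm_monoid_cancel_HM: "comm_monoid_cancel HM"
proof -
  interpret HM: comm_monoid HM by (rule submonoid_is_comm_monoid[OF submonoid])
  show ?thesis
  proof (intro comm_monoid_cancelI HM.comm_monoid_axioms)
    fix a b c assume "a \<otimes>\<^bsub>HM\<^esub> c = b \<otimes>\<^bsub>HM\<^esub> c" "a \<in> carrier HM" "b \<in> carrier HM" "c \<in> carrier HM"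
    then show "a = b" using r_cancel[of a c b] H_carrier by simp
  qed
qed

lemma Units_HM: "Units HM = {\<one>}"
proof
  show "Units HM \<subseteq> {\<one>}"
  proof
    fix a assume "a \<in> Units HM"
    then obtain b where ab: "a \<in> H" "b \<in> H" "a \<otimes> b = \<one>" by (auto simp: Units_def)
    \<comment> \<open>The right-hand side is \<open>{#}\<close>, and a sum of multisets is empty
      only if both summands are.\<close>
    then have "block a + block b = block \<one>" using block_mult H_carrier by metis
    then show "a \<in> {\<one>}" using block_eq_empty_iff[of a] block_eq_empty_iff[of \<one>] ab H_carrier by auto
  qed
  show "{\<one>} \<subseteq> Units HM" using submonoid.one_closed[OF submonoid]
    by (auto simp: Units_def intro!: bexI[of _ \<one>])
qed

text \<open>A decomposition of the product inside \<open>H\<close> induces one of the class sequence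
  into two zero-sum sequences. One of these is empty, and only \<open>\<one>\<close> has an empty
  block.\<close>

lemma atom_of_block_atom:
  assumes T: "set_mset T \<subseteq> P" and atom: "image_mset cls T \<in> atoms B"
  shows "mset_prod F T \<in> atoms HM"
proof -
  interpret HM: comm_monoid_cancel HM by (rule comm_monoid_cancel_HM)
  interpret B: comm_monoid_cancel B by (rule comm_monoid_cancel_B)
  let ?a = "mset_prod F T"
  have atom': "image_mset cls T \<in> carrier B" "image_mset cls T \<noteq> {#}"
    "\<And>U V. U \<in> carrier B \<Longrightarrow> V \<in> carrier B \<Longrightarrow> image_mset cls T = U + V \<Longrightarrow> U = {#} \<or> V = {#}"
    using atom by (simp_all add: B.mem_atoms_iff Units_B)
  have H: "?a \<in> H" using mset_prod_mem_iff[OF T] atom' by blast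
  have "?a \<noteq> \<one>" using pf_mset_prod[OF T] pf_one atom'(2) by auto
  moreover have "u = \<one> \<or> v = \<one>" if "u \<in> H" "v \<in> H" "?a = u \<otimes> v" for u v
  proof -
    have "image_mset cls T = block u + block v"
      using that block_mset_prod[OF T] block_mult H_carrier by metis
    then show ?thesis
      using atom'(3) block_mem that(1,2) block_eq_empty_iff H_carrier by metis
  qed
  ultimately show ?thesis using H by (simp add: HM.mem_atoms_iff Units_HM)
qed

lemma mset_prod_foldr_plus:
  assumes "\<And>T. T \<in> set Ts \<Longrightarrow> set_mset T \<subseteq> P"
  shows "set_mset (foldr (+) Ts {#}) \<subseteq> P \<and>
    mset_prod F (foldr (+) Ts {#}) = foldr (\<otimes>) (map (mset_prod F) Ts) \<one>"
  using assms by (induction Ts) (auto simp: mset_prod_P_plus)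

lemma foldr_plus_superset:
  "T \<in> set Ts \<Longrightarrow> set_mset T \<subseteq> set_mset (foldr (+) Ts {#})"
  by (induction Ts) auto

text \<open>A sharp form of (WT2): the blocks of the lifted atoms are the given atoms themselves, in
  the given order. Cut \<open>pf a\<close> along \<open>vs\<close> and multiply out each
  piece.\<close>

lemma block_factors_lift:
  assumes a: "a \<in> H" and vs: "set vs \<subseteq> atoms B" "factors B vs (block a)"
  shows "\<exists>us. map block us = vs \<and> set us \<subseteq> atoms HM \<and> factors HM us a"
proof -
  have ac: "a \<in> carrier F" using a H_carrier by simp
  \<comment> \<open>Needed as an equation between functions, because the operation occurs unapplied
    inside \<open>foldr\<close>.\<close>
  have "(\<otimes>\<^bsub>B\<^esub>) = (+)" by (intro ext) simp
  then have "image_mset cls (pf a) = foldr (+) vs {#}"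
    using vs(2) by (simp add: factors_def block_def)
  then obtain Ts where Ts: "map (image_mset cls) Ts = vs" "foldr (+) Ts {#} = pf a"
    using image_mset_eq_foldr_plusD by blast
  \<comment> \<open>Each piece is contained in \<open>pf a\<close>, hence consists of
    primes.\<close>
  have TP: "set_mset T \<subseteq> P" if "T \<in> set Ts" for T
    using foldr_plus_superset[OF that] Ts(2) pf(1)[OF ac] by simp
  let ?us = "map (mset_prod F) Ts"
  have "map block ?us = vs"
    using Ts(1) TP block_mset_prod by auto
  moreover have us: "set ?us \<subseteq> atoms HM"
    using atom_of_block_atom[OF TP] vs(1) unfolding Ts(1)[symmetric] by auto
  moreover have "foldr (\<otimes>) ?us \<one> = a"
    using mset_prod_foldr_plus[of Ts] TP Ts(2) pf(2)[OF ac] by metis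
  then have "factors HM ?us a" using us by (auto simp: factors_def atoms_def)
  ultimately show ?thesis by (intro exI[of _ ?us] conjI)
qed

text \<open>Choosing a prime in each class occurring in a zero-sum sequence gives a product of
  primes, which lies in \<open>H\<close> because the sum of the classes is zero.\<close>

lemma block_surj: "block ` H = carrier B"
proof
  show "carrier B \<subseteq> block ` H"
  proof
    fix S assume S: "S \<in> carrier B"
    then obtain T where T: "set_mset T \<subseteq> P" "image_mset cls T = S"
      using exists_image_mset[of S cls P] by auto
    then have "mset_prod F T \<in> H" "block (mset_prod F T) = S"
      using mset_prod_mem_iff[OF T(1)] block_mset_prod S by blast+
    then show "S \<in> block ` H" by blast
  qed
qed (use block_mem in blast)

text \<open>Atomicity is pulled back from \<open>B\<close>: factor \<open>block a\<close> there and
  lift the factorization.\<close>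

lemma atomic_HM: "atomic_monoid HM"
  unfolding atomic_monoid_def
proof
  fix a assume "a \<in> carrier HM - Units HM"
  then have a: "a \<in> H" "a \<noteq> \<one>" by (auto simp: Units_HM)
  then have "block a \<in> carrier B - Units B"
    using block_mem block_eq_empty_iff H_carrier by (simp add: Units_B)
  then obtain vs where vs: "set vs \<subseteq> atoms B" "factors B vs (block a)"
    using atomic_B unfolding atomic_monoid_def by blast
  then show "\<exists>us. set us \<subseteq> atoms HM \<and> factors HM us a"
    using block_factors_lift[OF a(1)] by blast
qed

lemma block_hom: "monoid_homomorphism HM B block"
proof -
  have "block \<one> = {#}" by (simp add: block_eq_empty_iff)
  moreover have "block \<in> hom HM B"
    by (rule homI) (simp_all add: block_mem block_mult H_carrier del: zero_sum_monoid_simps(1))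
  ultimately show ?thesis by (simp add: monoid_homomorphism_def)
qed

lemma transfer_homomorphism_block: "transfer_homomorphism HM B block"
  unfolding transfer_homomorphism_def
proof (intro conjI)
  \<comment> \<open>With \<open>{#}\<close> as the only unit of \<open>B\<close>, this half of (T1)
    is surjectivity of \<open>block\<close>.\<close>
  show "carrier B = Units B <#>\<^bsub>B\<^esub> (block ` carrier HM) <#>\<^bsub>B\<^esub> Units B"
    unfolding Units_B using block_surj by (auto simp: set_mult_def simp del: zero_sum_monoid_simps(1))
  show "{a \<in> carrier HM. block a \<in> Units B} = Units HM"
    unfolding Units_B Units_HM
    by (auto simp: block_eq_empty_iff H_carrier submonoid.one_closed[OF submonoid])
next
  show "\<forall>a \<in> carrier HM. \<forall>vs. vs \<noteq> [] \<and> set vs \<subseteq> atoms B \<and> factors B vs (block a) \<longrightarrow>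
      (\<exists>us \<tau>. length us = length vs \<and> set us \<subseteq> atoms HM \<and> factors HM us a \<and>
        \<tau> permutes {..<length vs} \<and>
        (\<forall>i < length vs. block (us ! i) \<in> Units B <#>\<^bsub>B\<^esub> {vs ! \<tau> i} <#>\<^bsub>B\<^esub> Units B))"
  proof (intro allI ballI impI)
    fix a vs assume "a \<in> carrier HM" "vs \<noteq> [] \<and> set vs \<subseteq> atoms B \<and> factors B vs (block a)"
    then obtain us where us: "map block us = vs" "set us \<subseteq> atoms HM" "factors HM us a"
      using block_factors_lift[of a vs] by auto
    \<comment> \<open>The lift preserves the order of \<open>vs\<close>, so the identity serves as
      the permutation.\<close>
    then have "length us = length vs \<and> set us \<subseteq> atoms HM \<and> factors HM us a \<and>
        id permutes {..<length vs} \<and>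
        (\<forall>i < length vs. block (us ! i) \<in> Units B <#>\<^bsub>B\<^esub> {vs ! id i} <#>\<^bsub>B\<^esub> Units B)"
      by (auto simp: Units_B set_mult_def permutes_id)
    then show "\<exists>us \<tau>. length us = length vs \<and> set us \<subseteq> atoms HM \<and> factors HM us a \<and>
        \<tau> permutes {..<length vs} \<and>
        (\<forall>i < length vs. block (us ! i) \<in> Units B <#>\<^bsub>B\<^esub> {vs ! \<tau> i} <#>\<^bsub>B\<^esub> Units B)"
      by (intro exI[of _ us] exI[of _ id])
  qed
qed (fact comm_monoid_cancel_HM atomic_HM comm_monoid_cancel_B atomic_B block_hom)+

end

theorem proposition4p3:
  fixes F :: "('f, 'r) monoid_scheme" and P H :: "'f set"
  assumes "free_abelian_monoid F P"
    and "submonoid H F"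
    and "reduced_monoid (F\<lparr>carrier := H\<rparr>)"
    and "krull_monoid (F\<lparr>carrier := H\<rparr>)"
    and "divisor_homomorphism (F\<lparr>carrier := H\<rparr>) F (\<lambda>a. a)"
    and "cofinal_homomorphism (F\<lparr>carrier := H\<rparr>) F (\<lambda>a. a)"
  shows "(\<exists>\<beta>. transfer_homomorphism (F\<lparr>carrier := H\<rparr>)
                (zero_sum_monoid (class_group F H) (divisor_class F H ` P)) \<beta>)
       \<and> system_of_lengths (F\<lparr>carrier := H\<rparr>) =
           system_of_lengths (zero_sum_monoid (class_group F H) (divisor_class F H ` P))"
proof -
  interpret comm_monoid_cancel F using assms(1) by (simp add: free_abelian_monoid_def)
  interpret free_abelian_divisor_submonoid F P H
    using assms(1,2,5) comm_monoid_cancel_axioms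
    by (intro free_abelian_divisor_submonoid.intro free_abelian_divisor_submonoid_axioms.intro)
  \<comment> \<open>The witness for \<open>\<beta>\<close> is \<open>block\<close>; equality of the
    systems of lengths then holds as for any transfer homomorphism.\<close>
  show ?thesis
    using transfer_homomorphism_block transfer_homomorphism_system_of_lengths by blast
qed

end
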